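(* Let $n,d$ be positive integers with $n\geq d\geq 3$. Then $$\mu(Q_n)\geq \frac{1}{d}\left(\sum_{r=d}^{n-d}\mathrm{ex}\left(n,\mathcal{D}_r(2d,d)\right)+2\sum_{r=0}^{d-1}\binom{n}{r}\right).$$
   Context: For a positive integer $n$, write $[n]=\{1,\dots,n\}$, and let $\binom{[n]}{r}$ be the family of all $r$-element subsets of $[n]$. The $n$-dimensional hypercube $Q_n$ is the graph on the vertex set $2^{[n]}$ (all subsets of $[n]$), where $A,B\in 2^{[n]}$ are adjacent if and only if $|A\Delta B|=1$, with $A\Delta B=(A\setminus B)\cup(B\setminus A)$. Let $G$ be a simple graph and $M\subseteq V(G)$. Two vertices $u,v\in V(G)$ are $M$-visible if there exists a shortest $u,v$-path in $G$ that contains no vertices from $M\setminus\{u,v\}$. The set $M$ is a mutual-visibility set if any two vertices $u,v\in M$ are $M$-visible. The mutual-visibility number $\mu(G)$ is the largest size of a mutual-visibility set in $G$. For positive integers $r,s,t$ with $\min\{r,s\}\geq t$, an $(r,s,t)$-daisy $\mathcal{D}_r(s,t)$ is a collection of all $r$-element sets $T$ satisfying $A\subseteq T\subseteq B$, for some given sets $A\subseteq B$ with $|A|=r-t$ and $|B|=r+s-t$. The Turán number $\mathrm{ex}(n,\mathcal{D}_r(s,t))$ is the largest size of a family $\mathcal{F}_r\subseteq\binom{[n]}{r}$ containing no $(r,s,t)$-daisy (as a subfamily). A sum over an empty range is $0$. *)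

theory Defs
  imports Complex_Main "HOL-Library.Ramsey" "Graph_Theory.Graph_Theory"
begin

section \<open>Mutual visibility\<close>

text \<open>
  Simple graphs are finite symmetric loop-free digraphs without parallel arcs, that is,
  instances of the locale \<^locale>\<open>graph\<close>. Paths are given by their lists of vertices.
\<close>

definition shortest_vpath :: "('a, 'b) pre_digraph \<Rightarrow> 'a \<Rightarrow> 'a \<Rightarrow> 'a vwalk \<Rightarrow> bool" where
  "shortest_vpath G u v p \<longleftrightarrow>
     vpath p G \<and> hd p = u \<and> last p = v \<and>
     (\<forall>q. vpath q G \<and> hd q = u \<and> last q = v \<longrightarrow> vwalk_length p \<le> vwalk_length q)"

definition visible :: "('a, 'b) pre_digraph \<Rightarrow> 'a set \<Rightarrow> 'a \<Rightarrow> 'a \<Rightarrow> bool" where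
  "visible G M u v \<longleftrightarrow> (\<exists>p. shortest_vpath G u v p \<and> set p \<inter> (M - {u, v}) = {})"

definition mutual_visibility_set :: "('a, 'b) pre_digraph \<Rightarrow> 'a set \<Rightarrow> bool" where
  "mutual_visibility_set G M \<longleftrightarrow> M \<subseteq> verts G \<and> (\<forall>u\<in>M. \<forall>v\<in>M. visible G M u v)"

text \<open>
  The maximum is taken over a finite set because \<open>G\<close> is finite, and over a nonempty one
  because the empty set is a mutual-visibility set.
\<close>

definition mutual_visibility_number :: "('a, 'b) pre_digraph \<Rightarrow> nat" where
  "mutual_visibility_number G = Max {card M | M. mutual_visibility_set G M}"

section \<open>The hypercube\<close>

definition hypercube :: "nat \<Rightarrow> nat set pair_pre_digraph" where
  "hypercube n =
     \<lparr> pverts = Pow {1..n},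
       parcs = {(A, B). A \<subseteq> {1..n} \<and> B \<subseteq> {1..n} \<and> card (sym_diff A B) = 1} \<rparr>"

lemma graph_hypercube: "graph (with_proj (hypercube n))"
proof -
  have "finite (parcs (hypercube n))"
    by (rule finite_subset[of _ "Pow {1..n} \<times> Pow {1..n}"]) (auto simp: hypercube_def)
  then show ?thesis
    by unfold_locales
      (auto simp: hypercube_def arc_to_ends_def symmetric_def sym_def Un_commute)
qed

section \<open>Daisies and their Turan numbers\<close>

text \<open>
  Daisies are only meant for \<open>0 < t\<close>, \<open>t \<le> r\<close> and \<open>t \<le> s\<close>, where the subtractions on
  \<^typ>\<open>nat\<close> below are not truncated. \<open>[B]\<^bsup>r\<^esup>\<close> is the set of all \<open>r\<close>-element subsets of \<open>B\<close>.
\<close>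

definition daisy :: "nat \<Rightarrow> nat \<Rightarrow> nat \<Rightarrow> 'a set set \<Rightarrow> bool" where
  "daisy r s t D \<longleftrightarrow>
     (\<exists>A B. finite B \<and> A \<subseteq> B \<and> card A = r - t \<and> card B = r + s - t \<and>
            D = {T \<in> [B]\<^bsup>r\<^esup>. A \<subseteq> T})"

text \<open>The Turan number \<open>ex(n, D\<^sub>r(s, t))\<close>.\<close>

definition ex_daisy :: "nat \<Rightarrow> nat \<Rightarrow> nat \<Rightarrow> nat \<Rightarrow> nat" where
  "ex_daisy n r s t =
     Max {card F | F. F \<subseteq> [{1..n}]\<^bsup>r\<^esup> \<and> \<not> (\<exists>D. daisy r s t D \<and> D \<subseteq> F)}"

end

theory Submission
  imports Defs
begin

text \<open>
  Choose for every \<open>r\<close> with \<open>d \<le> r \<le> n - d\<close> an extremal daisy-free family of \<open>r\<close>-sets, and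
  for all other \<open>r\<close> the full layer. For each residue \<open>i\<close>, the union \<open>M\<close> of the chosen families
  with \<open>r\<close> congruent to \<open>i\<close> modulo \<open>d\<close> is a mutual-visibility set: since \<open>d \<ge> 3\<close>, two
  consecutive free layers lie next to every layer meeting \<open>M\<close>, and a geodesic can
  exchange elements by zigzagging between them. A layer of \<open>M\<close> strictly between those of the
  endpoints is crossed at a set missing from \<open>M\<close>, which daisy-freeness provides between a set
  \<open>d\<close> layers below and one \<open>d\<close> layers above. If \<open>2 * d \<le> n + 1\<close>, summing over the \<open>d\<close> residues
  gives the bound.
\<close>

section \<open>Geodesics avoiding a set\<close>

text \<open>
  There is a geodesic of the hypercube from \<open>U\<close> to \<open>V\<close> whose vertices strictly between
  \<open>U\<close> and \<open>V\<close> avoid \<open>M\<close>. The endpoints themselves may belong to \<open>M\<close>.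
\<close>

inductive clear :: "'a set set \<Rightarrow> 'a set \<Rightarrow> 'a set \<Rightarrow> bool" for M where
  here: "clear M V V"
| up: "\<lbrakk>x \<in> V - U; insert x U = V \<or> insert x U \<notin> M; clear M (insert x U) V\<rbrakk> \<Longrightarrow> clear M U V"
| down: "\<lbrakk>x \<in> U - V; U - {x} = V \<or> U - {x} \<notin> M; clear M (U - {x}) V\<rbrakk> \<Longrightarrow> clear M U V"

text \<open>The last two premises put \<open>T\<close> in the interval between \<open>U\<close> and
  \<open>V\<close>, that is, on some geodesic, so the two pieces concatenate without undoing a
  change. \<open>T\<close> becomes an interior vertex, hence the demand that it avoid
  \<open>M\<close>.\<close>

lemma clear_trans:
  assumes "clear M U T" "clear M T V" "T \<notin> M" "U \<inter> V \<subseteq> T" "T \<subseteq> U \<union> V"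
  shows "clear M U V"
  using assms
proof (induction rule: clear.induct)
  case here
  then show ?case by simp
next
  case (up x T U)
  have "clear M (insert x U) V" using up by (intro up.IH) auto
  moreover have "x \<in> V - U" "insert x U \<notin> M" using up by auto
  ultimately show ?case by (blast intro: clear.up)
next
  case (down x U T)
  have "clear M (U - {x}) V" using down by (intro down.IH) auto
  moreover have "x \<in> U - V" "U - {x} \<notin> M" using down by auto
  ultimately show ?case by (blast intro: clear.down)
qed

lemma clear_insert: "x \<notin> U \<Longrightarrow> clear M U (insert x U)"
  by (rule clear.up[of x]) (auto intro: clear.here)

lemma clear_remove: "x \<in> U \<Longrightarrow> clear M U (U - {x})"
  by (rule clear.down[of x]) (auto intro: clear.here)

text \<open>\<open>clear\<close> grows at its first endpoint, so reversal appends the inverse step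
  at the far end by \<open>clear_trans\<close>. The intermediate set is outside \<open>M\<close>
  unless it is already the other endpoint, which the case split treats separately.\<close>

lemma clear_sym:
  assumes "clear M U V"
  shows "clear M V U"
  using assms
proof (induction rule: clear.induct)
  case here
  show ?case by (rule clear.here)
next
  case (up x V U)
  have rev: "clear M (insert x U) U" using clear_remove[of x "insert x U" M] up(1) by simp
  show ?case
  proof (cases "insert x U = V")
    case False
    then show ?thesis using up rev by (intro clear_trans[OF up.IH rev]) auto
  qed (use rev in simp)
next
  case (down x U V)
  have rev: "clear M (U - {x}) U" using clear_insert[of x "U - {x}" M] down(1)
    by (simp add: insert_absorb)
  show ?case
  proof (cases "U - {x} = V")
    case False
    then show ?thesis using down rev by (intro clear_trans[OF down.IH rev]) auto
  qed (use rev in simp)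
qed

section \<open>From \<open>clear\<close> to shortest paths of the graph\<close>

text \<open>An arc changes exactly one element; the triangle inequality for symmetric differences
  then gives the lower bound that makes a \<open>clear\<close> route a shortest path.\<close>

lemma card_sym_diff_le_vwalk_length:
  assumes "vwalk p (with_proj (hypercube n))"
  shows "card (sym_diff (hd p) (last p)) \<le> vwalk_length p"
  using assms
proof (induction rule: vwalk_induct)
  case (Base u)
  then show ?case by simp
next
  case (Cons u v es)
  let ?w = "last (v # es)"
  have uv: "card (sym_diff u v) = 1" "finite (sym_diff u v)"
    using Cons(1) by (auto simp: hypercube_def intro: finite_subset)
  show ?case
  proof (cases "finite (sym_diff v ?w)")
    case True
    have "card (sym_diff u ?w) \<le> card (sym_diff u v \<union> sym_diff v ?w)"
      using uv(2) True by (intro card_mono) auto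
    also have "\<dots> \<le> card (sym_diff u v) + card (sym_diff v ?w)" by (rule card_Un_le)
    finally show ?thesis using uv(1) Cons(2) by simp
  next
    case False
    \<comment> \<open>The induction does not record that vertices are subsets of
      \<open>{1..n}\<close>. Here both symmetric differences are infinite, and \<open>card\<close>
      of an infinite set is 0.\<close>
    have "sym_diff v ?w \<subseteq> sym_diff u v \<union> sym_diff u ?w" by auto
    then have "infinite (sym_diff u ?w)"
      using False uv(2) by (meson finite_UnI finite_subset)
    then show ?thesis by simp
  qed
qed

text \<open>No vertex of \<open>p\<close> is farther from \<open>V\<close> than \<open>W\<close> is,
  while \<open>U\<close> is one step farther. Hence \<open>U\<close> is not on \<open>p\<close>, and
  prepending it keeps the vertices distinct. The induction in \<open>clear_vpath\<close> carries the
  distance bound along for this purpose.\<close>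

lemma clear_vwalk_step:
  fixes n :: nat
  defines "G \<equiv> with_proj (hypercube n)"
  assumes p: "vpath p G" "hd p = W" "last p = V"
      "length p = Suc (card (sym_diff W V))" "set p \<inter> M \<subseteq> {W, V}"
      "\<forall>S\<in>set p. card (sym_diff S V) \<le> card (sym_diff W V)"
    and "W = V \<or> W \<notin> M" and UW: "(U, W) \<in> parcs (hypercube n)"
    and less: "card (sym_diff U V) = Suc (card (sym_diff W V))"
  shows "\<exists>p. vpath p G \<and> hd p = U \<and> last p = V \<and>
      length p = Suc (card (sym_diff U V)) \<and> set p \<inter> M \<subseteq> {U, V} \<and>
      (\<forall>S\<in>set p. card (sym_diff S V) \<le> card (sym_diff U V))"
proof (intro exI[of _ "U # p"] conjI)
  have "U \<notin> set p" using p(6) less by auto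
  moreover have "vwalk (U # p) G"
    using p UW by (intro vwalk_consI) (auto simp: G_def hypercube_def vpath_def)
  ultimately show "vpath (U # p) G" using p(1) by (auto simp: vpath_def)
  show "last (U # p) = V" using p by (auto simp: vpath_def vwalk_def)
  show "set (U # p) \<inter> M \<subseteq> {U, V}" using p(5) assms(8) by auto
  show "\<forall>S\<in>set (U # p). card (sym_diff S V) \<le> card (sym_diff U V)"
    using p(6) less by auto
qed (use p less in auto)

lemma clear_vpath:
  fixes n :: nat
  defines "G \<equiv> with_proj (hypercube n)"
  assumes "clear M U V" "U \<subseteq> {1..n}" "V \<subseteq> {1..n}"
  shows "\<exists>p. vpath p G \<and> hd p = U \<and> last p = V \<and>
      length p = Suc (card (sym_diff U V)) \<and> set p \<inter> M \<subseteq> {U, V} \<and>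
      (\<forall>S\<in>set p. card (sym_diff S V) \<le> card (sym_diff U V))"
  using assms(2-4)
proof (induction rule: clear.induct)
  case (here V)
  then show ?case
    by (intro exI[of _ "[V]"]) (use here in \<open>auto simp: vpath_def vwalk_def G_def hypercube_def\<close>)
next
  case (up x V U)
  have fin: "finite (sym_diff U V)" using up.prems by (auto intro: finite_subset)
  have eq: "sym_diff U V = insert x (sym_diff (insert x U) V)"
    "sym_diff U (insert x U) = {x}" using up(1) by auto
  have less: "card (sym_diff U V) = Suc (card (sym_diff (insert x U) V))"
    unfolding eq using fin eq(1) up(1) by (subst card_insert_disjoint) auto
  have arc: "(U, insert x U) \<in> parcs (hypercube n)"
    using up(1) up.prems eq(2) by (auto simp: hypercube_def)
  have "insert x U \<subseteq> {1..n}" using up(1) up.prems by auto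
  then obtain p where "vpath p G" "hd p = insert x U" "last p = V"
      "length p = Suc (card (sym_diff (insert x U) V))" "set p \<inter> M \<subseteq> {insert x U, V}"
      "\<forall>S\<in>set p. card (sym_diff S V) \<le> card (sym_diff (insert x U) V)"
    using up.IH up.prems(2) by metis
  then show ?case
    unfolding G_def by (rule clear_vwalk_step) (fact up(2) arc less)+
next
  case (down x U V)
  have fin: "finite (sym_diff U V)" using down.prems by (auto intro: finite_subset)
  have eq: "sym_diff U V = insert x (sym_diff (U - {x}) V)"
    "sym_diff U (U - {x}) = {x}" using down(1) by auto
  have less: "card (sym_diff U V) = Suc (card (sym_diff (U - {x}) V))"
    unfolding eq using fin eq(1) down(1) by (subst card_insert_disjoint) auto
  have arc: "(U, U - {x}) \<in> parcs (hypercube n)"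
    using down(1) down.prems eq(2) by (auto simp: hypercube_def)
  have "U - {x} \<subseteq> {1..n}" using down(1) down.prems by auto
  then obtain p where "vpath p G" "hd p = U - {x}" "last p = V"
      "length p = Suc (card (sym_diff (U - {x}) V))" "set p \<inter> M \<subseteq> {U - {x}, V}"
      "\<forall>S\<in>set p. card (sym_diff S V) \<le> card (sym_diff (U - {x}) V)"
    using down.IH down.prems(2) by metis
  then show ?case
    unfolding G_def by (rule clear_vwalk_step) (fact down(2) arc less)+
qed

lemma visible_if_clear:
  assumes "clear M U V" "U \<subseteq> {1..n}" "V \<subseteq> {1..n}"
  shows "visible (with_proj (hypercube n)) M U V"
proof -
  obtain p where p: "vpath p (with_proj (hypercube n))" "hd p = U" "last p = V"
      "length p = Suc (card (sym_diff U V))" "set p \<inter> M \<subseteq> {U, V}"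
    using clear_vpath[OF assms] by blast
  have "vwalk_length p \<le> vwalk_length q"
    if "vpath q (with_proj (hypercube n))" "hd q = U" "last q = V" for q
    using that p(4) card_sym_diff_le_vwalk_length[of q n] by (auto simp: vpath_def)
  then have "shortest_vpath (with_proj (hypercube n)) U V p"
    using p(1-3) unfolding shortest_vpath_def by blast
  then show ?thesis
    using p(5) unfolding visible_def by blast
qed

lemma card_le_mutual_visibility_number:
  assumes "M \<subseteq> Pow {1..n}"
    and clear: "\<And>U V. \<lbrakk>U \<in> M; V \<in> M; U \<noteq> V; card U \<le> card V\<rbrakk> \<Longrightarrow> clear M U V"
  shows "card M \<le> mutual_visibility_number (with_proj (hypercube n))"
  unfolding mutual_visibility_number_def
proof (rule Max_ge)
  have "clear M U V" if "U \<in> M" "V \<in> M" for U V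
  proof -
    consider "U = V" | "U \<noteq> V" "card U \<le> card V" | "V \<noteq> U" "card V \<le> card U"
      using linear[of "card U" "card V"] by blast
    then show ?thesis
    proof cases
      case 1
      then show ?thesis by (simp add: clear.here)
    next
      case 2
      then show ?thesis using that by (intro clear)
    next
      case 3
      then show ?thesis using that by (intro clear_sym[OF clear])
    qed
  qed
  then have "visible (with_proj (hypercube n)) M U V" if "U \<in> M" "V \<in> M" for U V
    using that assms(1) by (intro visible_if_clear) auto
  then have "mutual_visibility_set (with_proj (hypercube n)) M"
    using assms(1) unfolding mutual_visibility_set_def by (simp add: hypercube_def)
  then show "card M \<in> {card M |M. mutual_visibility_set (with_proj (hypercube n)) M}" by blast
  have "{M. mutual_visibility_set (with_proj (hypercube n)) M} \<subseteq> Pow (Pow {1..n})"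
    unfolding mutual_visibility_set_def by (simp add: hypercube_def subset_iff)
  then have "finite {M. mutual_visibility_set (with_proj (hypercube n)) M}"
    by (rule finite_subset) simp
  then show "finite {card M |M. mutual_visibility_set (with_proj (hypercube n)) M}"
    by (rule finite_image_set)
qed

section \<open>Zigzag geodesics in a band of free layers\<close>

text \<open>The route adds a missing element of \<open>Y\<close> whenever this stays below
  \<open>hi\<close>, and otherwise removes an element outside \<open>Y\<close>. Every step brings it
  closer to \<open>Y\<close>, and two free layers give enough room.\<close>

lemma clear_band_down:
  assumes "finite X" "finite Y" "lo + 3 \<le> hi"
    and free: "\<And>W. lo < card W \<Longrightarrow> card W < hi \<Longrightarrow> W \<notin> M"
    and "lo < card X" "card X < hi" "card Y = lo"
  shows "clear M X Y"
  using assms(1,5,6)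
proof (induction "card (sym_diff X Y)" arbitrary: X rule: less_induct)
  case less
  show ?case
  proof (cases "card X + 1 < hi \<and> Y - X \<noteq> {}")
    case True
    then obtain y where y: "y \<in> Y - X" by blast
    have "sym_diff (insert y X) Y \<subset> sym_diff X Y" using y by auto
    then have "card (sym_diff (insert y X) Y) < card (sym_diff X Y)"
      using less.prems(1) assms(2) by (intro psubset_card_mono) auto
    moreover have card: "card (insert y X) = card X + 1" using y less.prems by simp
    ultimately have "clear M (insert y X) Y"
      using less.prems True by (intro less.hyps) auto
    moreover have "insert y X \<notin> M" using less.prems True card by (intro free) auto
    ultimately show ?thesis using clear.up[OF y] by blast
  next
    case False
    have "\<not> X \<subseteq> Y" using less.prems assms(2,7) by (metis card_mono leD)
    then obtain x where x: "x \<in> X - Y" by blast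
    have "sym_diff (X - {x}) Y \<subset> sym_diff X Y" using x by auto
    then have lt: "card (sym_diff (X - {x}) Y) < card (sym_diff X Y)"
      using less.prems(1) assms(2) by (intro psubset_card_mono) auto
    have card: "card (X - {x}) = card X - 1" using x less.prems by simp
    show ?thesis
    proof (cases "X - {x} = Y")
      case True
      then show ?thesis using x clear_remove by (metis DiffD1)
    next
      case neq: False
      \<comment> \<open>On the lowest layer of the band there is always room to add, so no addition
        was made only because \<open>Y\<close> is contained in \<open>X\<close>. As \<open>X\<close>
        has one element more than \<open>Y\<close>, removing \<open>x\<close> would already have
        reached \<open>Y\<close>.\<close>
      have "lo < card (X - {x})"
      proof (rule ccontr)
        assume "\<not> ?thesis"
        then have *: "card X = lo + 1" using card less.prems by simp
        then have "Y \<subseteq> X" using False assms(3) by auto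
        then show False using neq * x card assms(7) less.prems(1)
          by (metis Diff_empty add_diff_cancel_right' card_subset_eq finite_Diff subset_Diff_insert
              DiffD2)
      qed
      then have "clear M (X - {x}) Y"
        using less.prems lt card by (intro less.hyps) auto
      moreover have "X - {x} \<notin> M" using less.prems \<open>lo < card (X - {x})\<close> card by (intro free) auto
      ultimately show ?thesis using clear.down[OF x] by blast
    qed
  qed
qed

text \<open>This is \<open>clear_band_down\<close> under complementation: removals within the band
  come first, and additions are made only when none is possible.\<close>

lemma clear_band_up:
  assumes "finite X" "finite Y" "lo + 3 \<le> hi"
    and free: "\<And>W. lo < card W \<Longrightarrow> card W < hi \<Longrightarrow> W \<notin> M"
    and "lo < card X" "card X < hi" "card Y = hi"
  shows "clear M X Y"
  using assms(1,5,6)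
proof (induction "card (sym_diff X Y)" arbitrary: X rule: less_induct)
  case less
  show ?case
  proof (cases "lo + 1 < card X \<and> X - Y \<noteq> {}")
    case True
    then obtain y where y: "y \<in> X - Y" by blast
    have "sym_diff (X - {y}) Y \<subset> sym_diff X Y" using y by auto
    then have "card (sym_diff (X - {y}) Y) < card (sym_diff X Y)"
      using less.prems(1) assms(2) by (intro psubset_card_mono) auto
    moreover have card: "card (X - {y}) = card X - 1" using y less.prems by simp
    ultimately have "clear M (X - {y}) Y"
      using less.prems True by (intro less.hyps) auto
    moreover have "X - {y} \<notin> M" using less.prems True card by (intro free) auto
    ultimately show ?thesis using clear.down[OF y] by blast
  next
    case False
    have "\<not> Y \<subseteq> X" using less.prems assms(7) by (metis card_mono leD)
    then obtain x where x: "x \<in> Y - X" by blast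
    have "sym_diff (insert x X) Y \<subset> sym_diff X Y" using x by auto
    then have lt: "card (sym_diff (insert x X) Y) < card (sym_diff X Y)"
      using less.prems(1) assms(2) by (intro psubset_card_mono) auto
    have card: "card (insert x X) = card X + 1" using x less.prems by simp
    show ?thesis
    proof (cases "insert x X = Y")
      case True
      then show ?thesis using x clear_insert by (metis DiffD2)
    next
      case neq: False
      have "card (insert x X) < hi"
      proof (rule ccontr)
        assume "\<not> ?thesis"
        then have *: "card X + 1 = hi" using card less.prems by simp
        then have "insert x X \<subseteq> Y" using False assms(3) x by auto
        then show False using neq * x card assms(2,7)
          by (metis card_subset_eq)
      qed
      then have "clear M (insert x X) Y"
        using less.prems lt card by (intro less.hyps) auto
      moreover have "insert x X \<notin> M" using less.prems \<open>card (insert x X) < hi\<close> card by (intro free) auto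
      ultimately show ?thesis using clear.up[OF x] by blast
    qed
  qed
qed

text \<open>One step up enters the band of layers \<open>r + 1\<close> and \<open>r + 2\<close>,
  from which \<open>clear_band_down\<close> descends to \<open>Y\<close>.\<close>

lemma clear_same_layer:
  assumes "finite X" "finite Y" "card X = r" "card Y = r"
    and free: "\<And>W. card W = r + 1 \<or> card W = r + 2 \<Longrightarrow> W \<notin> M"
  shows "clear M X Y"
proof (cases "Y \<subseteq> X")
  case True
  then show ?thesis using assms by (metis card_subset_eq clear.here)
next
  case False
  then obtain y where y: "y \<in> Y - X" by blast
  then have card: "card (insert y X) = r + 1" using assms(1,3) by simp
  have band: "W \<notin> M" if "r < card W" "card W < r + 3" for W
    using that by (intro free) linarith
  have "clear M (insert y X) Y"
    by (rule clear_band_down[OF _ _ _ band]) (use assms(1-4) card in auto)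
  then show ?thesis using clear.up[OF y] free card by blast
qed

lemma clear_next_layer:
  assumes "finite X" "finite Y" "card X = lo" "card Y = hi" "lo + 3 \<le> hi"
    and free: "\<And>W. lo < card W \<Longrightarrow> card W < hi \<Longrightarrow> W \<notin> M"
  shows "clear M X Y"
proof -
  have "\<not> Y \<subseteq> X"
  proof
    assume "Y \<subseteq> X"
    then have "card Y \<le> card X" using assms(1) by (rule card_mono[rotated])
    then show False using assms(3-5) by simp
  qed
  then obtain y where y: "y \<in> Y - X" by blast
  then have card: "card (insert y X) = lo + 1" using assms(1,3) by simp
  have "clear M (insert y X) Y"
    by (rule clear_band_up[OF _ _ _ free]) (use assms(1-5) card in auto)
  moreover have "insert y X \<notin> M" using card assms(5) by (intro free) auto
  ultimately show ?thesis using clear.up[OF y] by blast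
qed

section \<open>Layers in one residue class\<close>

lemma add_le_if_mod_eq:
  fixes a b d :: nat
  assumes "b mod d = a mod d" "a < b"
  shows "a + d \<le> b"
proof -
  have "d dvd b - a" using mod_eq_dvd_iff_nat[of a b d] assms by simp
  then have "d \<le> b - a" using assms(2) by (intro dvd_imp_le) simp_all
  then show ?thesis using assms(2) by simp
qed

text \<open>Each round climbs \<open>d\<close> layers to a set \<open>T\<close> outside
  \<open>M\<close> that still lies between \<open>X\<close> and \<open>Y\<close>. \<open>X\<close>
  ranges over all sets of the residue class, so that the induction hypothesis applies to
  \<open>T\<close>.\<close>

lemma clear_layers_mod:
  assumes "3 \<le> d" "finite S"
    and layers: "\<And>W. W \<in> M \<Longrightarrow> card W mod d = i"
    and gap: "\<And>A B. \<lbrakk>A \<subseteq> B; B \<subseteq> S; card A mod d = i; card B = card A + 2 * d\<rbrakk>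
      \<Longrightarrow> \<exists>T. A \<subseteq> T \<and> T \<subseteq> B \<and> card T = card A + d \<and> T \<notin> M"
    and "X \<subseteq> S" "Y \<subseteq> S" "card X mod d = i" "card Y = card X + Suc j * d"
  shows "clear M X Y"
  using assms(5,7,8)
proof (induction j arbitrary: X)
  case 0
  have free: "W \<notin> M" if "card X < card W" "card W < card Y" for W
  proof
    assume "W \<in> M"
    then have "card W mod d = card X mod d" using layers 0(2) by simp
    then have "card X + d \<le> card W"
      using that by (intro add_le_if_mod_eq) auto
    then show False using that 0(3) by simp
  qed
  show ?case
    by (rule clear_next_layer[OF _ _ refl refl _ free])
      (use 0 assms(1,2,6) in \<open>auto intro: finite_subset\<close>)
next
  case (Suc j)
  have fin: "finite X" "finite Y" using Suc.prems(1) assms(2,6) by (auto intro: finite_subset)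
  have cardY: "card Y = card X + 2 * d + j * d" using Suc.prems(3) by simp
  have "card (X \<inter> Y) \<le> card X" using fin by (intro card_mono) auto
  \<comment> \<open>\<open>A\<close> stands in for \<open>X\<close> inside \<open>Y\<close>: it has
    the same size and keeps the common part of \<open>X\<close> and \<open>Y\<close>. Every
    \<open>T\<close> between \<open>A\<close> and \<open>B\<close> then lies between
    \<open>X\<close> and \<open>Y\<close> as \<open>clear_trans\<close> asks.\<close>
  then obtain A where A: "X \<inter> Y \<subseteq> A" "A \<subseteq> Y" "card A = card X"
    using exists_subset_between[of "X \<inter> Y" "card X" Y] fin cardY by auto
  obtain B where B: "A \<subseteq> B" "B \<subseteq> Y" "card B = card A + 2 * d"
    using exists_subset_between[of A "card X + 2 * d" Y] A fin cardY by auto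
  obtain T where T: "A \<subseteq> T" "T \<subseteq> B" "card T = card A + d" "T \<notin> M"
    using gap[OF B(1) _ _ B(3)] B(2) assms(6) A(3) Suc.prems(2) by auto
  have free: "W \<notin> M" if "card X < card W" "card W < card T" for W
  proof
    assume "W \<in> M"
    then have "card W mod d = card X mod d" using layers Suc.prems(2) by simp
    then have "card X + d \<le> card W"
      using that by (intro add_le_if_mod_eq) auto
    then show False using that T(3) A(3) by simp
  qed
  have subs: "T \<subseteq> Y" "X \<inter> Y \<subseteq> T" using A B T by auto
  have "clear M X T"
    by (rule clear_next_layer[OF _ _ refl refl _ free])
      (use fin subs T(3) A(3) assms(1) in \<open>auto intro: finite_subset\<close>)
  moreover have "clear M T Y"
    using subs assms(6) T(3) A(3) Suc.prems cardY by (intro Suc.IH) auto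
  ultimately show ?case
    using T(4) subs by (intro clear_trans[of M X T Y]) auto
qed

lemma card_layers_mod_le_mutual_visibility_number:
  assumes "3 \<le> d" "M \<subseteq> Pow {1..n}"
    and layers: "\<And>W. W \<in> M \<Longrightarrow> card W mod d = i"
    and gap: "\<And>A B. \<lbrakk>A \<subseteq> B; B \<subseteq> {1..n}; card A mod d = i; card B = card A + 2 * d\<rbrakk>
      \<Longrightarrow> \<exists>T. A \<subseteq> T \<and> T \<subseteq> B \<and> card T = card A + d \<and> T \<notin> M"
  shows "card M \<le> mutual_visibility_number (with_proj (hypercube n))"
proof (rule card_le_mutual_visibility_number[OF assms(2)])
  fix X Y assume XY: "X \<in> M" "Y \<in> M" "X \<noteq> Y" "card X \<le> card Y"
  have sub: "X \<subseteq> {1..n}" "Y \<subseteq> {1..n}" using XY assms(2) by auto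
  show "clear M X Y"
  proof (cases "card X = card Y")
    case True
    have free: "W \<notin> M" if "card W = card X + 1 \<or> card W = card X + 2" for W
    proof
      assume "W \<in> M"
      then have "card W mod d = card X mod d" using layers XY(1) by simp
      then have "card X + d \<le> card W"
        using that by (intro add_le_if_mod_eq) auto
      then show False using that assms(1) by simp
    qed
    show ?thesis
      by (rule clear_same_layer[OF _ _ refl _ free]) (use sub True in \<open>auto intro: finite_subset\<close>)
  next
    case False
    then have lt: "card X < card Y" using XY by simp
    have "card Y mod d = card X mod d" using layers XY by simp
    then have "d dvd card Y - card X"
      using mod_eq_dvd_iff_nat[of "card X" "card Y" d] lt by auto
    then obtain k where k: "card Y - card X = d * k" by blast
    then obtain j where "k = Suc j" using lt by (cases k) auto
    then have "card Y = card X + Suc j * d" using k lt by (simp add: algebra_simps)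
    then show ?thesis
      using clear_layers_mod[of d "{1..n}" M i X Y j] assms(1) layers gap sub XY(1) by simp
  qed
qed

section \<open>Averaging over residues, and extremal daisy-free families\<close>

lemma sum_card_layers_le:
  assumes "3 \<le> d"
    and F: "\<And>r. r \<le> n \<Longrightarrow> F r \<subseteq> [{1..n}]\<^bsup>r\<^esup>"
    and free: "\<And>r D. \<lbrakk>d \<le> r; r + d \<le> n; daisy r (2 * d) d D\<rbrakk> \<Longrightarrow> \<not> D \<subseteq> F r"
  shows "(\<Sum>r\<le>n. card (F r)) \<le> d * mutual_visibility_number (with_proj (hypercube n))"
proof -
  let ?R = "\<lambda>i. {r \<in> {..n}. r mod d = i}"
  have finF: "finite (F r)" if "r \<le> n" for r
    using F[OF that] by (rule finite_subset) (simp add: finite_imp_finite_nsets)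
  have cardF: "card W = r" if "W \<in> F r" "r \<le> n" for W r
    using F[OF that(2)] that(1) by (auto simp: nsets_def)
  have le: "(\<Sum>r\<in>?R i. card (F r)) \<le> mutual_visibility_number (with_proj (hypercube n))" for i
  proof -
    have "card (\<Union>r\<in>?R i. F r) = (\<Sum>r\<in>?R i. card (F r))"
    proof (rule card_UN_disjoint)
      show "\<forall>r\<in>?R i. \<forall>s\<in>?R i. r \<noteq> s \<longrightarrow> F r \<inter> F s = {}"
        using cardF by (metis (no_types, lifting) atMost_iff disjoint_iff mem_Collect_eq)
    qed (use finF in auto)
    moreover have "card (\<Union>r\<in>?R i. F r) \<le> mutual_visibility_number (with_proj (hypercube n))"
    proof (rule card_layers_mod_le_mutual_visibility_number[OF assms(1), where i = i])
      show "(\<Union>r\<in>?R i. F r) \<subseteq> Pow {1..n}" using F by (fastforce simp: nsets_def)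
      show "card W mod d = i" if "W \<in> (\<Union>r\<in>?R i. F r)" for W
        using that cardF by auto
      fix A B :: "nat set"
      assume AB: "A \<subseteq> B" "B \<subseteq> {1..n}" "card A mod d = i" "card B = card A + 2 * d"
      \<comment> \<open>Layer \<open>r\<close> is halfway between \<open>A\<close> and
        \<open>B\<close>, so the \<open>r\<close>-sets between them form a daisy with the parameters
        \<open>r\<close>, \<open>2 * d\<close>, \<open>d\<close>. Since \<open>B\<close> fits into
        \<open>{1..n}\<close>, \<open>r\<close> is in the range where \<open>F r\<close> is
        daisy-free.\<close>
      define r where "r = card A + d"
      have "card B \<le> n" using card_mono[OF _ AB(2)] by simp
      then have r: "d \<le> r" "r + d \<le> n" using AB(4) by (auto simp: r_def)
      have "finite B" using AB(2) by (auto intro: finite_subset)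
      then have "daisy r (2 * d) d {T \<in> [B]\<^bsup>r\<^esup>. A \<subseteq> T}"
        unfolding daisy_def using AB by (intro exI[of _ A] exI[of _ B]) (simp add: r_def)
      then obtain T where T: "T \<in> [B]\<^bsup>r\<^esup>" "A \<subseteq> T" "T \<notin> F r" using free[OF r] by blast
      have "T \<notin> F s" if "s \<le> n" for s
        using T(1,3) cardF[OF _ that, of T] by (auto simp: nsets_def)
      then show "\<exists>T. A \<subseteq> T \<and> T \<subseteq> B \<and> card T = card A + d \<and> T \<notin> (\<Union>r\<in>?R i. F r)"
        using T(1,2) by (intro exI[of _ T]) (auto simp: nsets_def r_def)
    qed
    ultimately show ?thesis by simp
  qed
  have "(\<Sum>r\<le>n. card (F r)) = (\<Sum>i<d. \<Sum>r\<in>?R i. card (F r))"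
    using assms(1) by (intro sum.group[symmetric]) auto
  also have "\<dots> \<le> (\<Sum>i<d. mutual_visibility_number (with_proj (hypercube n)))"
    using le by (rule sum_mono)
  finally show ?thesis by simp
qed

text \<open>The maximum in \<open>ex_daisy\<close> is over a finite set. It is nonempty because
  every daisy with these parameters has a member, so the empty family is daisy-free.\<close>

lemma ex_daisy_attained:
  assumes "0 < t" "t \<le> r" "t \<le> s"
  obtains F where "F \<subseteq> [{1..n}]\<^bsup>r\<^esup>" "\<And>D. daisy r s t D \<Longrightarrow> \<not> D \<subseteq> F"
    "card F = ex_daisy n r s t"
proof -
  let ?P = "\<lambda>F. F \<subseteq> [{1..n}]\<^bsup>r\<^esup> \<and> \<not> (\<exists>D. daisy r s t D \<and> D \<subseteq> F)"
  have "{F. ?P F} \<subseteq> Pow ([{1..n}]\<^bsup>r\<^esup>)" by blast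
  then have "finite {F. ?P F}"
    by (rule finite_subset) (simp add: finite_imp_finite_nsets)
  then have fin: "finite {card F | F. ?P F}" by (rule finite_image_set)
  have "D \<noteq> {}" if D: "daisy r s t D" for D :: "nat set set"
  proof -
    obtain A B where AB: "finite B" "A \<subseteq> B" "card A = r - t" "card B = r + s - t"
        "D = {T \<in> [B]\<^bsup>r\<^esup>. A \<subseteq> T}"
      using D unfolding daisy_def by blast
    have "card A \<le> r" "r \<le> card B" using AB(3,4) assms(3) by linarith+
    from exists_subset_between[OF this AB(2,1)]
    obtain T where "A \<subseteq> T" "T \<subseteq> B" "card T = r" by blast
    then show ?thesis using AB by (auto simp: nsets_def intro: finite_subset)
  qed
  then have "?P {}" by blast
  then have "card ({} :: nat set set) \<in> {card F | F. ?P F}"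
    by (intro CollectI exI[of _ "{}"] conjI[OF HOL.refl])
  then have "{card F | F. ?P F} \<noteq> {}" by (rule ex_in_conv[THEN iffD1, OF exI])
  from Max_in[OF fin this] obtain F where F: "ex_daisy n r s t = card F" "?P F"
    unfolding ex_daisy_def by (elim CollectE exE) simp
  then show ?thesis using that[of F] by simp
qed

lemma card_nsets:
  assumes "finite A"
  shows "card ([A]\<^bsup>k\<^esup>) = card A choose k"
proof -
  have "[A]\<^bsup>k\<^esup> = {B. B \<subseteq> A \<and> card B = k}"
    unfolding nsets_def using assms finite_subset by blast
  then show ?thesis using n_subsets[OF assms] by simp
qed

lemma ex_daisy_sum_le:
  assumes "3 \<le> d" "2 * d \<le> n + 1"
  shows "(\<Sum>r = d..n - d. ex_daisy n r (2 * d) d) + 2 * (\<Sum>r<d. n choose r)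
    \<le> d * mutual_visibility_number (with_proj (hypercube n))"
proof -
  have "\<exists>F. F \<subseteq> [{1..n}]\<^bsup>r\<^esup> \<and> (\<forall>D. daisy r (2 * d) d D \<longrightarrow> \<not> D \<subseteq> F) \<and>
      card F = ex_daisy n r (2 * d) d" if "d \<le> r" for r
    using ex_daisy_attained[of d r "2 * d" n] that assms(1) by (metis le_add2 mult_2 not_numeral_le_zero
      not_gr_zero)
  then obtain E where E: "\<And>r. d \<le> r \<Longrightarrow> E r \<subseteq> [{1..n}]\<^bsup>r\<^esup>"
    "\<And>r D. d \<le> r \<Longrightarrow> daisy r (2 * d) d D \<Longrightarrow> \<not> D \<subseteq> E r"
    "\<And>r. d \<le> r \<Longrightarrow> card (E r) = ex_daisy n r (2 * d) d"
    by metis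
  define F where "F r = (if d \<le> r \<and> r + d \<le> n then E r else [{1..n}]\<^bsup>r\<^esup>)" for r
  \<comment> \<open>For \<open>n = 2 * d - 1\<close> the middle range is empty, and the outer blocks
    are still disjoint and cover all layers.\<close>
  have split: "{..n} = {..<d} \<union> ({d..n - d} \<union> {n - d<..n})" using assms by auto
  have "(\<Sum>r\<le>n. card (F r)) =
      (\<Sum>r<d. card (F r)) + ((\<Sum>r = d..n - d. card (F r)) + (\<Sum>r\<in>{n - d<..n}. card (F r)))"
    unfolding split using assms by (subst sum.union_disjoint; auto)+
  also have "(\<Sum>r<d. card (F r)) = (\<Sum>r<d. n choose r)"
    by (intro sum.cong) (auto simp: F_def card_nsets)
  also have "(\<Sum>r = d..n - d. card (F r)) = (\<Sum>r = d..n - d. ex_daisy n r (2 * d) d)"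
    using E(3) assms by (intro sum.cong) (auto simp: F_def)
  also have "(\<Sum>r\<in>{n - d<..n}. card (F r)) = (\<Sum>r<d. n choose r)"
    by (rule sum.reindex_bij_witness[of _ "\<lambda>r. n - r" "\<lambda>r. n - r"])
      (use assms in \<open>auto simp: F_def card_nsets binomial_symmetric[symmetric]\<close>)
  finally have "(\<Sum>r\<le>n. card (F r)) =
      (\<Sum>r = d..n - d. ex_daisy n r (2 * d) d) + 2 * (\<Sum>r<d. n choose r)" by simp
  moreover have "(\<Sum>r\<le>n. card (F r)) \<le> d * mutual_visibility_number (with_proj (hypercube n))"
    using assms(1) E(1,2) by (intro sum_card_layers_le) (auto simp: F_def)
  ultimately show ?thesis by simp
qed

text \<open>Two free layers separate the full ones, and no geodesic needed here has to cross a layer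
  of \<open>M\<close>, so both layers can be taken whole.\<close>

lemma two_layers_le_mutual_visibility_number:
  fixes n :: nat
  shows "(n choose r) + (n choose (r + 3)) \<le> mutual_visibility_number (with_proj (hypercube n))"
proof -
  let ?M = "[{1..n}]\<^bsup>r\<^esup> \<union> [{1..n}]\<^bsup>(r + 3)\<^esup>"
  have "card ?M = (n choose r) + (n choose (r + 3))"
    by (subst card_Un_disjoint) (auto simp: finite_imp_finite_nsets card_nsets, auto simp: nsets_def)
  moreover have "card ?M \<le> mutual_visibility_number (with_proj (hypercube n))"
  proof (rule card_le_mutual_visibility_number)
    show "?M \<subseteq> Pow {1..n}" by (auto simp: nsets_def)
    have mem: "W \<in> ?M \<Longrightarrow> finite W \<and> (card W = r \<or> card W = r + 3)" for W
      by (auto simp: nsets_def)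
    fix X Y assume XY: "X \<in> ?M" "Y \<in> ?M" "card X \<le> card Y"
    show "clear ?M X Y"
    proof (cases "card X = card Y")
      case True
      have "W \<notin> ?M" if "card W = card X + 1 \<or> card W = card X + 2" for W
        using mem[of W] mem[OF XY(1)] mem[OF XY(2)] True that by linarith
      then show ?thesis
        using mem[OF XY(1)] mem[OF XY(2)] True by (intro clear_same_layer[of X Y "card X"]) simp_all
    next
      case False
      have "W \<notin> ?M" if "r < card W" "card W < r + 3" for W
        using mem[of W] that by linarith
      then show ?thesis
        using mem[OF XY(1)] mem[OF XY(2)] XY(3) False
        by (intro clear_next_layer[of X Y r "r + 3"]) auto
    qed
  qed
  ultimately show ?thesis by simp
qed

section \<open>Small dimension\<close>

lemma clear_upI: "\<lbrakk>x \<in> V; x \<notin> U; insert x U \<notin> M; clear M (insert x U) V\<rbrakk> \<Longrightarrow> clear M U V"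
  by (rule clear.up[of x]) simp_all

lemma clear_downI: "\<lbrakk>x \<notin> V; x \<notin> U; U \<notin> M; clear M U V\<rbrakk> \<Longrightarrow> clear M (insert x U) V"
  by (rule clear.down[of x]) simp_all

text \<open>
  For \<open>n \<le> 2 * d - 2\<close> the ranges \<open>r < d\<close> and \<open>n - r < d\<close> overlap, so the right-hand side of the
  theorem counts the middle layers twice and averaging over residues is not enough. Two full
  layers at distance 3 suffice when \<open>7 \<le> n\<close>. The dimensions 3 to 6 need a full layer
  together with a few smaller sets.
\<close>

lemma choose_two_le_mutual_visibility_number:
  assumes "2 \<le> n"
  shows "(n choose 2) + 2 \<le> mutual_visibility_number (with_proj (hypercube n))"
proof -
  define M where "M = [{1..n}]\<^bsup>2\<^esup> \<union> {{1}, {2}}"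
  have mem: "W \<in> M \<longleftrightarrow> W \<subseteq> {1..n} \<and> card W = 2 \<or> W = {1} \<or> W = {2}" for W
    unfolding M_def nsets_def by (auto intro: finite_subset)
  have "[{1..n}]\<^bsup>2\<^esup> \<inter> {{1}, {2}} = {}" by (auto simp: nsets_def)
  then have "card M = (n choose 2) + 2"
    unfolding M_def by (subst card_Un_disjoint) (simp_all add: finite_imp_finite_nsets card_nsets)
  moreover have "card M \<le> mutual_visibility_number (with_proj (hypercube n))"
  proof (rule card_le_mutual_visibility_number)
    show "M \<subseteq> Pow {1..n}" using assms unfolding M_def nsets_def by auto
    have empty: "{} \<notin> M" unfolding mem by simp
    have single: "clear M {a} Y" if ab: "{a, b} = {1, 2}" and Y: "card Y = 2" for a b Y
    proof (cases "a \<in> Y")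
      case True
      then obtain y where "Y = insert y {a}" "y \<notin> {a}"
        using Y by (auto simp: card_2_iff)
      then show ?thesis using clear_insert[of y "{a}" M] by simp
    next
      case False
      \<comment> \<open>Since \<open>a\<close> is not in \<open>Y\<close>, avoiding \<open>b\<close>
        is enough to put \<open>{q}\<close> outside \<open>M\<close>. The route runs from
        \<open>{a}\<close> through \<open>{}\<close> and \<open>{q}\<close> to
        \<open>Y\<close>.\<close>
      obtain q where q: "q \<in> Y" "q \<noteq> b" using Y by (auto simp: card_2_iff)
      obtain p where p: "Y = insert p {q}" "p \<notin> {q}" using Y q(1) by (auto simp: card_2_iff)
      have "q \<noteq> 1" "q \<noteq> 2" using ab q False by auto
      then have "{q} \<notin> M" unfolding mem by auto
      moreover have "clear M {q} Y" using clear_insert[of p "{q}" M] p by simp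
      ultimately have "clear M {} Y" using q(1) by (intro clear_upI[of q Y "{}"]) simp_all
      then show ?thesis using False empty clear_downI[of a Y "{}" M] by simp
    qed
    fix X Y assume XY: "X \<in> M" "Y \<in> M" "X \<noteq> Y" "card X \<le> card Y"
    have pair: "clear M {a} {b}" if "a \<noteq> b" for a b
    proof (rule clear_downI)
      show "clear M {} {b}" by (rule clear_insert) simp
    qed (use that empty in simp_all)
    consider "card X = 2" "card Y = 2" | a b where "{a, b} = {1, 2}" "X = {a}" "card Y = 2"
      | a b where "X = {a}" "Y = {b}"
    proof -
      have "card X = 2 \<or> X = {1} \<or> X = {2}" "card Y = 2 \<or> Y = {1} \<or> Y = {2}"
        using XY(1,2) unfolding mem by blast+
      then show thesis using that XY(4) by (elim disjE) (simp_all add: insert_commute)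
    qed
    then show "clear M X Y"
    proof cases
      case 1
      have "W \<notin> M" if "card W = 2 + 1 \<or> card W = 2 + 2" for W
        using that unfolding mem by auto
      then show ?thesis using 1
        by (intro clear_same_layer[of X Y 2]) (simp_all add: card_ge_0_finite)
    next
      case 2
      then show ?thesis using single by blast
    next
      case 3
      then show ?thesis using pair XY(3) by simp
    qed
  qed
  ultimately show ?thesis by simp
qed

text \<open>All singletons are free. As the two added pairs are disjoint, pairs mixing them are
  free, and of two distinct pairs sharing an element at most one is in \<open>M\<close>. The empty
  set is in \<open>M\<close>, so routes between other members must go around it.\<close>

lemma choose_three_le_mutual_visibility_number:
  assumes "4 \<le> n"
  shows "(n choose 3) + 3 \<le> mutual_visibility_number (with_proj (hypercube n))"
proof -
  define M where "M = [{1..n}]\<^bsup>3\<^esup> \<union> {{}, {1, 2}, {3, 4}}"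
  have mem: "W \<in> M \<longleftrightarrow> W \<subseteq> {1..n} \<and> card W = 3 \<or> W = {} \<or> W = {1, 2} \<or> W = {3, 4}" for W
    unfolding M_def nsets_def by (auto intro: finite_subset)
  have "[{1..n}]\<^bsup>3\<^esup> \<inter> {{}, {1, 2}, {3, 4}} = {}" by (auto simp: nsets_def)
  moreover have "card {{}, {1, 2}, {3, 4 :: nat}} = 3" by (simp add: doubleton_eq_iff)
  ultimately have "card M = (n choose 3) + 3"
    unfolding M_def by (subst card_Un_disjoint) (simp_all add: finite_imp_finite_nsets card_nsets)
  moreover have "card M \<le> mutual_visibility_number (with_proj (hypercube n))"
  proof (rule card_le_mutual_visibility_number)
    show "M \<subseteq> Pow {1..n}" using assms unfolding M_def nsets_def by auto
    have free1: "{a} \<notin> M" for a unfolding mem by (simp add: singleton_insert_inj_eq')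
    have free2: "{p, q} \<notin> M" if "{p, q} \<noteq> {1, 2}" "{p, q} \<noteq> {3, 4}" for p q
      using that unfolding mem by (simp add: card_insert_if)
    have single: "clear M {p} Y" if "p \<in> Y" "card Y = 3" for p Y
    proof -
      have "card (Y - {p}) = 2" using that by simp
      then obtain q s where qs: "Y - {p} = {q, s}" "q \<noteq> s" by (auto simp: card_2_iff)
      have Y: "Y = {p, q, s}" "q \<noteq> p" "s \<noteq> p" using qs that(1) by blast+
      have step: "clear M {p} Y"
        if q: "{q, p} \<notin> M" "Y = {s, q, p}" "q \<noteq> p" "s \<noteq> p" "s \<noteq> q" for q s
      proof (rule clear_upI[of q])
        show "clear M {q, p} Y" unfolding q(2) using q(4,5) by (intro clear_insert) simp
      qed (use q in simp_all)
      \<comment> \<open>The two pairs share \<open>p\<close>; if both were in \<open>M\<close>, they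
        would coincide, against \<open>q \<noteq> s\<close>.\<close>
      have "{q, p} \<notin> M \<or> {s, p} \<notin> M"
      proof (rule ccontr)
        assume "\<not> ?thesis"
        then have "{q, p} = {1, 2} \<or> {q, p} = {3, 4}" "{s, p} = {1, 2} \<or> {s, p} = {3, 4}"
          using free2 by blast+
        then show False using qs(2) by (auto simp: doubleton_eq_iff)
      qed
      moreover have "Y = {s, q, p}" "Y = {q, s, p}" using Y(1) by blast+
      ultimately show ?thesis using step[of q s] step[of s q] Y(2,3) qs(2) by metis
    qed
    have from_pair: "clear M {b, a} Y"
      if ab: "{b, a} = {1, 2} \<or> {b, a} = {3, 4}" and Y: "card Y = 3" "b \<notin> Y" for a b Y
    proof (rule clear_downI)
      show "clear M {a} Y"
      proof (cases "a \<in> Y")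
        case True
        then show ?thesis using single Y by blast
      next
        case False
        \<comment> \<open>\<open>p\<close> is added before \<open>a\<close> is removed, to avoid the
          empty set. Neither \<open>a\<close> nor \<open>b\<close> is in \<open>Y\<close>, so
          \<open>{p, a}\<close> differs from both special pairs.\<close>
        obtain p where p: "p \<in> Y" using Y(1) by fastforce
        then have "{p, a} \<notin> M"
          using ab Y(2) False by (intro free2) (auto simp: doubleton_eq_iff)
        moreover have "clear M {a, p} Y"
          by (rule clear_downI) (use False p free1 single Y(1) in auto)
        moreover have "p \<noteq> a" using p False by blast
        ultimately show ?thesis
          using p by (intro clear_upI[of p Y "{a}"]) (simp_all add: insert_commute)
      qed
    qed (use ab Y(2) free1 in \<open>auto simp: doubleton_eq_iff\<close>)
    have pair_3: "clear M {a, b} Y"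
      if ab: "{a, b} = {1, 2} \<or> {a, b} = {3, 4}" and Y: "card Y = 3" for a b Y
    proof (cases "{a, b} \<subseteq> Y")
      case True
      have "card {a, b} = 2" using ab by (auto simp: doubleton_eq_iff)
      then have "card (Y - {a, b}) = 1" using True Y by (simp add: card_Diff_subset)
      then obtain y where "Y - {a, b} = {y}" by (auto simp: card_1_singleton_iff)
      then have "Y = insert y {a, b}" "y \<notin> {a, b}" using True by blast+
      then show ?thesis using clear_insert[of y "{a, b}" M] by simp
    next
      case False
      then show ?thesis using from_pair[of a b Y] from_pair[of b a Y] ab Y
        by (auto simp: insert_commute)
    qed
    have pairs: "clear M {a, b} {c, e}"
      if "{a, b} = {1, 2} \<and> {c, e} = {3, 4} \<or> {a, b} = {3, 4} \<and> {c, e} = {1, 2}" for a b c e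
    proof -
      have ne: "a \<noteq> b" "c \<noteq> e" "a \<notin> {c, e}" "b \<notin> {c, e}"
        using that by (auto simp: doubleton_eq_iff)
      \<comment> \<open>The route through the mixed pair \<open>{c, b}\<close> again bypasses the
        empty set.\<close>
      have "{c, b} \<notin> M" using that by (intro free2) (auto simp: doubleton_eq_iff)
      moreover have "clear M {c} {c, e}"
        using clear_insert[of e "{c}" M] ne(2) by (simp add: insert_commute)
      then have "clear M {c, b} {c, e}"
        using ne free1 clear_downI[of b "{c, e}" "{c}" M] by (auto simp: insert_commute)
      ultimately have "clear M {b} {c, e}"
        using ne by (intro clear_upI[of c _ "{b}"]) auto
      then show ?thesis using ne free1 clear_downI[of a "{c, e}" "{b}" M] by auto
    qed
    have from_empty: "clear M {} Y" if "p \<in> Y" "clear M {p} Y" for p Y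
      using that free1 by (intro clear_upI[of p Y "{}"]) simp_all
    have empty_pair: "clear M {} {a, b}" if "a \<noteq> b" for a b
      using that clear_insert[of a "{b}" M] by (intro from_empty[of b]) simp_all
    fix X Y assume XY: "X \<in> M" "Y \<in> M" "X \<noteq> Y" "card X \<le> card Y"
    have X: "card X = 3 \<or> X = {} \<or> X = {1, 2} \<or> X = {3, 4}"
      and Y: "card Y = 3 \<or> Y = {} \<or> Y = {1, 2} \<or> Y = {3, 4}"
      using XY(1,2) unfolding mem by blast+
    show "clear M X Y"
    proof (cases "card Y = 3")
      case Y3: True
      then obtain p where p: "p \<in> Y" by fastforce
      have "W \<notin> M" if "card W = 3 + 1 \<or> card W = 3 + 2" for W
        using that unfolding mem by auto
      then have "clear M X Y" if "card X = 3"
        using that Y3 by (intro clear_same_layer[of X Y 3]) (simp_all add: card_ge_0_finite)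
      then show ?thesis
        using X from_empty[OF p single[OF p Y3]] pair_3[of 1 2 Y] pair_3[of 3 4 Y] Y3 by auto
    next
      case False
      then have "card X \<noteq> 3" using Y XY(4) by auto
      then show ?thesis
        using X Y False XY(3,4) empty_pair[of 1 2] empty_pair[of 3 4] pairs[of 1 2 3 4]
          pairs[of 3 4 1 2] by auto
    qed
  qed
  ultimately show ?thesis by simp
qed

section \<open>Binomial estimates for two full layers\<close>

text \<open>The induction compares ratios of consecutive terms, with the ratio of the binomials
  given by \<open>rec\<close>. The base is 8192 \<le> 9009; at \<open>k = 5\<close> the inequality
  fails, as 2048 > 1980.\<close>

lemma four_power_le_choose:
  assumes "6 \<le> k"
  shows "2 * 4 ^ k \<le> (k + 1) * ((2 * k + 1) choose (k - 1))"
  using assms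
proof (induction k rule: nat_induct_at_least)
  case base
  have "13 choose 5 = (1287 :: nat)" by (simp add: eval_nat_numeral)
  then show ?case by simp
next
  case (Suc k)
  obtain j where j: "k = Suc j" using Suc.hyps by (cases k) auto
  let ?c = "(2 * j + 3) choose j" and ?c' = "(2 * j + 5) choose (j + 1)"
  have e: "Suc (2 * j + 4) = 2 * j + 5" "Suc j = j + 1" "2 * j + 4 - j = j + 4" "2 * j + 4 - 1 = 2 * j + 3"
    by simp_all
  have "(j + 1) * ?c' = (2 * j + 5) * ((2 * j + 4) choose j)"
    using Suc_times_binomial[of j "2 * j + 4"] unfolding e .
  moreover have "(j + 4) * ((2 * j + 4) choose j) = (2 * j + 4) * ?c"
    using binomial_absorb_comp[of "2 * j + 4" j] unfolding e .
  ultimately have rec: "(j + 1) * (j + 4) * ?c' = (2 * j + 5) * (2 * j + 4) * ?c"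
    by algebra
  have IH: "2 * 4 ^ k \<le> (j + 2) * ?c" using Suc.IH by (simp add: j numeral_3_eq_3)
  have "(j + 1) * (j + 4) * (2 * 4 ^ Suc k) = 4 * (j + 1) * (j + 4) * (2 * 4 ^ k)"
    by (simp only: power_Suc mult_ac)
  also have "\<dots> \<le> 4 * (j + 1) * (j + 4) * ((j + 2) * ?c)" by (intro mult_left_mono IH) simp
  also have "\<dots> = (4 * (j + 1) * (j + 4) * (j + 2)) * ?c" by (simp only: mult_ac)
  \<comment> \<open>After cancelling \<open>j + 2\<close> this reads
    \<open>4 * j^2 + 20 * j + 16 \<le> 4 * j^2 + 22 * j + 30\<close>.\<close>
  also have "\<dots> \<le> ((j + 3) * (2 * j + 5) * (2 * j + 4)) * ?c"
    by (intro mult_right_mono) (auto simp: algebra_simps)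
  also have "\<dots> = (j + 3) * ((2 * j + 5) * (2 * j + 4) * ?c)" by (simp only: mult.assoc)
  also have "\<dots> = (j + 1) * (j + 4) * ((j + 3) * ?c')" unfolding rec[symmetric] by (simp only: mult_ac)
  finally have "2 * 4 ^ Suc k \<le> (j + 3) * ?c'" by simp
  moreover have "Suc k + 1 = j + 3" "2 * Suc k + 1 = 2 * j + 5" "Suc k - 1 = j + 1"
    using j by simp_all
  ultimately show ?case by (simp only:)
qed


text \<open>
  For \<open>k = n div 2\<close>, the layers \<open>k - 2\<close> and \<open>k + 1\<close> (\<open>n\<close> even) or \<open>k - 1\<close> and \<open>k + 2\<close>
  (\<open>n\<close> odd) have together once or twice \<open>(2 * k + 1) choose (k - 1)\<close> elements.
\<close>

lemma sum_choose_le_mult_choose: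
  assumes "7 \<le> n" "n + 2 \<le> 2 * d" "d \<le> n"
  shows "2 * (\<Sum>r<d. n choose r) \<le>
    d * ((if even n then 1 else 2) * ((2 * (n div 2) + 1) choose (n div 2 - 1)))"
proof (cases "11 \<le> n")
  case True
  define k where "k = n div 2"
  let ?c = "(2 * k + 1) choose (k - 1)"
  have "(\<Sum>r<d. n choose r) \<le> (\<Sum>r\<le>n. n choose r)"
    using assms(3) by (intro sum_mono2) auto
  also have "\<dots> = 2 ^ n" by (rule choose_row_sum)
  finally have le: "2 * (\<Sum>r<d. n choose r) \<le> 2 * 2 ^ n" by simp
  show ?thesis
  proof (cases "even n")
    case even: True
    then have n: "n = 2 * k" by (simp add: k_def)
    have "2 * 2 ^ n \<le> (k + 1) * ?c"
      using four_power_le_choose[of k] True by (simp add: n power_mult)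
    also have "\<dots> \<le> d * ?c" using assms(2) by (intro mult_right_mono) (auto simp: n)
    finally show ?thesis using le even unfolding k_def[symmetric] by simp
  next
    case odd: False
    then have n: "n = 2 * k + 1" by (simp add: k_def)
    have "2 * 4 ^ k \<le> (k + 2) * ?c"
    \<comment> \<open>For \<open>n = 11\<close> the previous lemma is out of reach, but
      \<open>d \<ge> k + 2\<close> for odd \<open>n\<close> leaves a spare summand: 2048 \<le> 7 *
      330.\<close>
    proof (cases "k = 5")
      case True
      have "11 choose 4 = (330 :: nat)" by (simp add: eval_nat_numeral)
      then show ?thesis using True by simp
    next
      case False
      then have "2 * 4 ^ k \<le> (k + 1) * ?c"
        using \<open>11 \<le> n\<close> n by (intro four_power_le_choose) simp
      also have "\<dots> \<le> (k + 2) * ?c" by (intro mult_right_mono) auto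
      finally show ?thesis .
    qed
    then have "2 * 2 ^ n \<le> (k + 2) * (2 * ?c)"
      by (simp add: n power_add power_mult)
    also have "\<dots> \<le> d * (2 * ?c)" using assms(2) by (intro mult_right_mono) (auto simp: n)
    finally show ?thesis using le odd unfolding k_def[symmetric] by simp
  qed
next
  case False
  \<comment> \<open>For each of these \<open>n\<close> and the least possible \<open>d\<close>,
    replacing the sum by \<open>2 ^ n\<close> would lose too much, for instance 256 > 210 for
    \<open>n = 7\<close>, \<open>d = 5\<close>. The finitely many pairs are evaluated
    exactly.\<close>
  with assms have "n = 7 \<and> (d = 5 \<or> d = 6 \<or> d = 7) \<or> n = 8 \<and> (d = 5 \<or> d = 6 \<or> d = 7 \<or> d = 8)
      \<or> n = 9 \<and> (d = 6 \<or> d = 7 \<or> d = 8 \<or> d = 9)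
      \<or> n = 10 \<and> (d = 6 \<or> d = 7 \<or> d = 8 \<or> d = 9 \<or> d = 10)"
    by presburger
  then show ?thesis
    by (elim disjE conjE) (simp_all add: lessThan_nat_numeral lessThan_Suc binomial_code
        fold_atLeastAtMost_nat.simps fact_numeral)
qed

text \<open>For even \<open>n\<close>, symmetry turns the two layer sizes into neighbouring
  binomials, which Pascal's rule adds up to one in row \<open>n + 1\<close>. For odd
  \<open>n\<close>, the two layers mirror each other about the middle.\<close>

lemma choose_le_mutual_visibility_number:
  assumes "4 \<le> n"
  shows "(if even n then 1 else 2) * ((2 * (n div 2) + 1) choose (n div 2 - 1))
    \<le> mutual_visibility_number (with_proj (hypercube n))"
proof -
  obtain j where j: "n div 2 = j + 2" using assms by (metis add.commute div_le_mono le_Suc_ex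
    numeral_Bit0 nonzero_mult_div_cancel_left mult_2 zero_neq_numeral)
  show ?thesis
  proof (cases "even n")
    case True
    then have n: "n = 2 * j + 4" using j by auto
    have "(n choose j) + (n choose (j + 3)) = (n choose j) + (n choose (j + 1))"
      using binomial_symmetric[of "j + 3" n] by (simp add: n)
    also have "\<dots> = (Suc n choose Suc j)" by simp
    finally have "(Suc n choose Suc j) \<le> mutual_visibility_number (with_proj (hypercube n))"
      using two_layers_le_mutual_visibility_number[of n j] by simp
    moreover have "2 * (n div 2) + 1 = Suc n" "n div 2 - 1 = Suc j" using n j by simp_all
    ultimately show ?thesis using True by (simp only: if_True mult_1)
  next
    case False
    then have n: "n = 2 * j + 5" using j by presburger
    have "n - (j + 1 + 3) = j + 1" "j + 1 + 3 \<le> n" by (simp_all add: n)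
    then have "n choose (j + 1 + 3) = n choose (j + 1)"
      using binomial_symmetric[of "j + 1 + 3" n] by metis
    then have "2 * (n choose (j + 1)) \<le> mutual_visibility_number (with_proj (hypercube n))"
      using two_layers_le_mutual_visibility_number[of n "j + 1"] by linarith
    moreover have "2 * (n div 2) + 1 = n" "n div 2 - 1 = j + 1" using n j by simp_all
    ultimately show ?thesis using False by (simp only: if_False)
  qed
qed

lemma sum_choose_le_mutual_visibility_number:
  assumes "3 \<le> d" "d \<le> n" "n + 2 \<le> 2 * d"
  shows "2 * (\<Sum>r<d. n choose r) \<le> d * mutual_visibility_number (with_proj (hypercube n))"
proof (cases "7 \<le> n")
  case True
  have "2 * (\<Sum>r<d. n choose r) \<le>
      d * ((if even n then 1 else 2) * ((2 * (n div 2) + 1) choose (n div 2 - 1)))"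
    using sum_choose_le_mult_choose[OF True assms(3,2)] .
  also have "\<dots> \<le> d * mutual_visibility_number (with_proj (hypercube n))"
    using True by (intro mult_left_mono choose_le_mutual_visibility_number) auto
  finally show ?thesis .
next
  case False
  \<comment> \<open>For \<open>n = 4\<close> the set built on layer 2 is the larger one, from
    \<open>n = 5\<close> on the one built on layer 3. At \<open>n = 5\<close>, \<open>d = 4\<close>
    the estimate is an equality, 52 = 52.\<close>
  define b where "b = (if n \<le> 4 then (n choose 2) + 2 else (n choose 3) + 3)"
  from False assms have "n = 3 \<and> d = 3 \<or> n = 4 \<and> (d = 3 \<or> d = 4)
      \<or> n = 5 \<and> (d = 4 \<or> d = 5) \<or> n = 6 \<and> (d = 4 \<or> d = 5 \<or> d = 6)"
    by presburger
  then have "2 * (\<Sum>r<d. n choose r) \<le> d * b"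
    by (elim disjE conjE) (simp_all add: b_def lessThan_nat_numeral lessThan_Suc binomial_code
        fold_atLeastAtMost_nat.simps fact_numeral)
  also have "\<dots> \<le> d * mutual_visibility_number (with_proj (hypercube n))"
    using assms choose_two_le_mutual_visibility_number[of n]
      choose_three_le_mutual_visibility_number[of n]
    by (intro mult_left_mono) (auto simp: b_def)
  finally show ?thesis .
qed

theorem theorem1p3:
  fixes n d :: nat
  assumes "3 \<le> d" and "d \<le> n"
  shows "real (mutual_visibility_number (with_proj (hypercube n))) \<ge>
    1 / real d *
      ((\<Sum>r = d..n - d. real (ex_daisy n r (2 * d) d)) + 2 * (\<Sum>r = 0..d - 1. real (n choose r)))"
proof -
  have "(\<Sum>r = d..n - d. ex_daisy n r (2 * d) d) + 2 * (\<Sum>r<d. n choose r)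
    \<le> d * mutual_visibility_number (with_proj (hypercube n))"
  proof (cases "2 * d \<le> n + 1")
    case True
    then show ?thesis using ex_daisy_sum_le assms by simp
  next
    case False
    \<comment> \<open>Here \<open>n - d < d\<close>, so the sum of Turan numbers is empty.\<close>
    then show ?thesis using sum_choose_le_mutual_visibility_number[of d n] assms by simp
  qed
  then have "real ((\<Sum>r = d..n - d. ex_daisy n r (2 * d) d) + 2 * (\<Sum>r<d. n choose r))
    \<le> real (d * mutual_visibility_number (with_proj (hypercube n)))"
    by (rule of_nat_mono)
  moreover have "{0..d - 1} = {..<d}" using assms(1) by auto
  ultimately show ?thesis using assms(1) by (simp add: field_simps)
qed

end
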